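(* Let $N\ge 2$ and $m\ge 1$ be integers and let $x^{(r,s)}_k$ ($1\le r,s\le N$, $1\le k\le m$) be elements of a commutative ring; set $x^{(r,s)}_{m+1}=0$ for all $1\le r,s\le N$. Let $F(N,m)$ be the $Nm\times Nm$ matrix which, as an $N\times N$ block matrix with $m\times m$ blocks, has $(r,s)$ block $B_m(x^{(r,s)}_1,\dots,x^{(r,s)}_m)$ if $r$ is odd and $D_m(x^{(r,s)}_1,\dots,x^{(r,s)}_m)$ if $r$ is even. Then $$\det(F(N,m))=\begin{cases}(-1)^{\frac{Nm}{4}}\prod_{i=1}^{m}\det(X_{(i,i+1)}), & N \text{ even},\ m \text{ even},\\[2pt] (-1)^{\frac{N(m-1)}{4}}\prod_{i=1}^{m}\det(X_{(i,i+1)}), & N \text{ even},\ m \text{ odd},\\[2pt] (-1)^{\frac{(N-1)m}{4}}\prod_{i=1}^{m}\det(X_{(i,i+1)}), & N \text{ odd},\ m \text{ even},\\[2pt] (-1)^{\frac{(N-1)(m-1)}{4}}\prod_{i=1}^{m}\det(X_{(i,i+1)}), & N \text{ odd},\ m \text{ odd}.\end{cases}$$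
   Context: For elements $x_1,\dots,x_m$: $B_m(x_1,\dots,x_m)$ is the $m\times m$ matrix with $(p,q)$ entry $x_{\max(p,q)}$, and $D_m(x_1,\dots,x_m)$ is the $m\times m$ matrix with $(p,q)$ entry $x_{\max(m+1-p,\,q)}$. For $1\le i\le m$, $X_{(i,i+1)}$ is the $N\times N$ matrix whose $(r,s)$ entry is $x^{(r,s)}_i-x^{(r,s)}_{i+1}$. *)

theory Defs
  imports "Jordan_Normal_Form.Determinant"
begin

text \<open>
  Families \<open>x r s k\<close> and block positions \<open>(r, s)\<close> are indexed from 1, as in the mathematical
  text, while rows and columns of \<^typ>\<open>'a mat\<close> are indexed from 0: matrix position \<open>(i, j)\<close>
  is the entry \<open>(p, q) = (i + 1, j + 1)\<close>.
\<close>

definition B_mat :: "nat \<Rightarrow> (nat \<Rightarrow> 'a) \<Rightarrow> 'a mat" where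
  "B_mat m y = mat m m (\<lambda>(i, j). let p = i + 1; q = j + 1 in y (max p q))"

definition D_mat :: "nat \<Rightarrow> (nat \<Rightarrow> 'a) \<Rightarrow> 'a mat" where
  "D_mat m y = mat m m (\<lambda>(i, j). let p = i + 1; q = j + 1 in y (max (m + 1 - p) q))"

definition F_block :: "nat \<Rightarrow> (nat \<Rightarrow> nat \<Rightarrow> nat \<Rightarrow> 'a) \<Rightarrow> nat \<Rightarrow> nat \<Rightarrow> 'a mat" where
  "F_block m x r s = (if odd r then B_mat m (x r s) else D_mat m (x r s))"

text \<open>
  Row \<open>i\<close> of the large matrix is row \<open>i mod m\<close> of block row \<open>i div m + 1\<close>; likewise for columns.
\<close>

definition F_mat :: "nat \<Rightarrow> nat \<Rightarrow> (nat \<Rightarrow> nat \<Rightarrow> nat \<Rightarrow> 'a) \<Rightarrow> 'a mat" where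
  "F_mat N m x = mat (N * m) (N * m)
     (\<lambda>(i, j). F_block m x (i div m + 1) (j div m + 1) $$ (i mod m, j mod m))"

text \<open>\<open>X_mat N x i\<close> is the matrix $X_{(i,i+1)}$.\<close>

definition X_mat :: "nat \<Rightarrow> (nat \<Rightarrow> nat \<Rightarrow> nat \<Rightarrow> 'a :: minus) \<Rightarrow> nat \<Rightarrow> 'a mat" where
  "X_mat N x i = mat N N
     (\<lambda>(a, b). let r = a + 1; s = b + 1 in x r s i - x r s (i + 1))"

end

theory Submission
  imports Defs
begin

text \<open>
  The matrix \<open>D_m\<close> is \<open>B_m\<close> with its rows in reverse order. Reversing the \<open>m\<close> rows of
  each of the \<open>N div 2\<close> even block rows therefore replaces every \<open>D_m\<close> by \<open>B_m\<close>, at the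
  cost of the sign \<open>(-1) ^ ((N div 2) * (m div 2))\<close>. Exchanging the roles of block index and inner
  index, simultaneously for rows and columns, does not change the determinant and leaves the
  \<open>m \<times> m\<close> block matrix whose \<open>(k, l)\<close> block is \<open>Y\<close> at \<open>max k l\<close>, where
  \<open>Y k = (x r s k)\<close> is of size \<open>N \<times> N\<close>. Subtracting its last block row from all the
  others clears the last block column above \<open>Y m\<close> and turns each remaining \<open>Y k\<close> into
  \<open>Y k - Y m\<close>; the consecutive differences are unaffected, so induction on \<open>m\<close> applies.
\<close>

section \<open>Block triangular determinants over a commutative ring\<close>

text \<open>Induction on \<open>m\<close> peels off the last row and column: that column is zero
  except for its bottom entry 1.\<close>

lemma det_four_block_mat_one_lower_right:
  fixes A :: "'a :: comm_ring_1 mat"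
  assumes "A \<in> carrier_mat n n" "C \<in> carrier_mat m n"
  shows "det (four_block_mat A (0\<^sub>m n m) C (1\<^sub>m m)) = det A"
  using assms(2)
proof (induction m arbitrary: C)
  case 0
  then have "four_block_mat A (0\<^sub>m n 0) C (1\<^sub>m 0) = A"
    using assms by (intro eq_matI) auto
  then show ?case by simp
next
  case (Suc m)
  have last: "i = n + m" if "i < Suc (n + m)" "\<not> i < n + m" for i using that by linarith
  define C1 where "C1 = mat m n (($$) C)"
  define C2 where "C2 = mat 1 (n + m) (\<lambda>(i, j). if j < n then C $$ (m, j) else 0)"
  have "four_block_mat A (0\<^sub>m n (Suc m)) C (1\<^sub>m (Suc m)) =
    four_block_mat (four_block_mat A (0\<^sub>m n m) C1 (1\<^sub>m m)) (0\<^sub>m (n + m) 1) C2 (1\<^sub>m 1)"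
    using assms(1) Suc.prems by (intro eq_matI) (auto simp: C1_def C2_def dest: last)
  also have "det \<dots> = det (four_block_mat A (0\<^sub>m n m) C1 (1\<^sub>m m)) * det (1\<^sub>m 1 :: 'a mat)"
    by (rule det_four_block_mat_upper_right_zero_col[of _ "n + m"])
       (use assms(1) in \<open>auto simp: C1_def C2_def\<close>)
  finally show ?case using Suc.IH[of C1] by (simp add: C1_def)
qed

lemma det_four_block_mat_one_upper_left:
  fixes D :: "'a :: comm_ring_1 mat"
  assumes "D \<in> carrier_mat m m"
  shows "det (four_block_mat (1\<^sub>m n) (0\<^sub>m n m) (0\<^sub>m m n) D) = det D"
proof (induction n)
  case 0
  have "four_block_mat (1\<^sub>m 0) (0\<^sub>m 0 m) (0\<^sub>m m 0) D = D"
    using assms by (intro eq_matI) auto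
  then show ?case by simp
next
  case (Suc n)
  have "four_block_mat (1\<^sub>m (Suc n)) (0\<^sub>m (Suc n) m) (0\<^sub>m m (Suc n)) D =
    four_block_mat (1\<^sub>m 1) (0\<^sub>m 1 (n + m)) (0\<^sub>m (n + m) 1)
      (four_block_mat (1\<^sub>m n) (0\<^sub>m n m) (0\<^sub>m m n) D)"
    using assms by (intro eq_matI) auto
  also have "det \<dots> = det (1\<^sub>m 1 :: 'a mat) *
      det (four_block_mat (1\<^sub>m n) (0\<^sub>m n m) (0\<^sub>m m n) D)"
    by (rule det_four_block_mat_lower_left_zero_col[of _ _ "n + m"]) (use assms in auto)
  finally show ?case using Suc.IH by simp
qed

text \<open>The library version of this formula is restricted to integral domains.\<close>

lemma det_four_block_mat_upper_right_zero_comm_ring: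
  fixes A :: "'a :: comm_ring_1 mat"
  assumes [simp]: "A \<in> carrier_mat n n" "C \<in> carrier_mat m n" "D \<in> carrier_mat m m"
  shows "det (four_block_mat A (0\<^sub>m n m) C D) = det A * det D"
proof -
  have "four_block_mat A (0\<^sub>m n m) C D =
    four_block_mat A (0\<^sub>m n m) C (1\<^sub>m m) * four_block_mat (1\<^sub>m n) (0\<^sub>m n m) (0\<^sub>m m n) D"
    by (subst mult_four_block_mat[where ?nr1.0 = n and ?n1.0 = n and ?n2.0 = m and ?nr2.0 = m
        and ?nc1.0 = n and ?nc2.0 = m])
       (simp_all add: right_mult_one_mat[OF assms(1)] right_mult_one_mat[OF assms(2)]
         right_mult_zero_mat[OF assms(1)] right_mult_zero_mat[OF assms(2)]
         left_mult_zero_mat[OF assms(3)] left_mult_one_mat[OF assms(3)]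
         right_add_zero_mat[OF assms(1)] right_add_zero_mat[OF assms(2)]
         left_add_zero_mat[OF assms(3)])
  also have "det \<dots> = det (four_block_mat A (0\<^sub>m n m) C (1\<^sub>m m)) *
      det (four_block_mat (1\<^sub>m n) (0\<^sub>m n m) (0\<^sub>m m n) D)"
    by (rule det_mult[of _ "n + m"]) auto
  finally show ?thesis
    by (simp add: det_four_block_mat_one_lower_right det_four_block_mat_one_upper_left)
qed

section \<open>Block matrices governed by the maximum of the block indices\<close>

text \<open>The nesting is opposite to that of \<open>F_mat\<close>: here \<open>m\<close> is the
  number of blocks per row and \<open>N\<close> their size.\<close>

definition max_block_mat :: "nat \<Rightarrow> nat \<Rightarrow> (nat \<Rightarrow> nat \<Rightarrow> nat \<Rightarrow> 'a) \<Rightarrow> 'a mat" where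
  "max_block_mat N m Y = mat (m * N) (m * N)
     (\<lambda>(i, j). Y (max (i div N) (j div N)) (i mod N) (j mod N))"

lemma max_block_mat_carrier [simp]: "max_block_mat N m Y \<in> carrier_mat (m * N) (m * N)"
  by (simp add: max_block_mat_def)

lemma det_max_block_mat:
  fixes Y :: "nat \<Rightarrow> nat \<Rightarrow> nat \<Rightarrow> 'a :: comm_ring_1"
  assumes "\<And>a b. a < N \<Longrightarrow> b < N \<Longrightarrow> Y m a b = 0"
  shows "det (max_block_mat N m Y) =
    (\<Prod>k<m. det (mat N N (\<lambda>(a, b). Y k a b - Y (Suc k) a b)))"
  using assms
proof (induction m arbitrary: Y)
  case 0
  have "max_block_mat N 0 Y = 1\<^sub>m 0" by (intro eq_matI) (auto simp: max_block_mat_def)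
  then show ?case by simp
next
  case (Suc m)
  \<comment> \<open>\<open>Z m\<close> vanishes, so the induction hypothesis applies to
    \<open>Z\<close>, whose consecutive differences are those of \<open>Y\<close>.\<close>
  define Z where "Z k a b = Y k a b - Y m a b" for k a b
  define D where "D = mat N N (\<lambda>(a, b). Y m a b)"
  define C where "C = mat N (m * N) (\<lambda>(i, j). Y m i (j mod N))"
  \<comment> \<open>\<open>E\<close> stacks \<open>m\<close> identity matrices, so
    \<open>E * M\<close> stacks \<open>m\<close> copies of \<open>M\<close>, and left multiplication
    by \<open>U\<close> adds the last block row to all the others, undoing the subtraction.\<close>
  define E where "E = (mat (m * N) N (\<lambda>(i, j). if i mod N = j then 1 else 0) :: 'a mat)"
  define U where "U = four_block_mat (1\<^sub>m (m * N)) E (0\<^sub>m N (m * N)) (1\<^sub>m N)"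
  have [simp]: "C \<in> carrier_mat N (m * N)" "D \<in> carrier_mat N N" "E \<in> carrier_mat (m * N) N"
    by (simp_all add: C_def D_def E_def)
  have E_mult: "(E * M) $$ (i, j) = M $$ (i mod N, j)"
    if "M \<in> carrier_mat N nc" "i < m * N" "j < nc" for M nc i j
  proof -
    have "i mod N < N" using that(2) by (cases "N = 0") auto
    then have "(\<Sum>k = 0..<N. (if i mod N = k then 1 else 0) * M $$ (k, j)) = M $$ (i mod N, j)"
      by (simp add: if_distrib[of "\<lambda>t. t * _"] cong: if_cong)
    then show ?thesis using that by (simp add: E_def scalar_prod_def)
  qed
  have EC: "max_block_mat N m Z + E * C = mat (m * N) (m * N)
     (\<lambda>(i, j). Y (max (i div N) (j div N)) (i mod N) (j mod N))" (is "_ = ?R")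
  proof (intro eq_matI)
    fix i j assume "i < dim_row ?R" "j < dim_col ?R"
    then have ij: "i < m * N" "j < m * N" by auto
    then have "i mod N < N" by (cases "N = 0") auto
    with ij show "(max_block_mat N m Z + E * C) $$ (i, j) = ?R $$ (i, j)"
      using E_mult[of C "m * N" i j] by (simp add: max_block_mat_def Z_def C_def E_def)
  qed (auto simp: E_def C_def)
  have div_last: "i div N = m" "i mod N = i - m * N" if "m * N \<le> i" "i < N + m * N" for i
  proof -
    from that obtain t where "i = m * N + t" "t < N" by (metis add.commute le_Suc_ex nat_add_left_cancel_less)
    then show "i div N = m" "i mod N = i - m * N" by auto
  qed
  have block_index_less: "i div N < m" "i mod N < N" if "i < m * N" for i
    using that by (cases "N = 0"; auto simp: less_mult_imp_div_less)+
  have ED: "E * D = mat (m * N) N (\<lambda>(i, j). Y m (i mod N) j)" (is "_ = ?R")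
  proof (intro eq_matI)
    fix i j assume "i < dim_row ?R" "j < dim_col ?R"
    then have ij: "i < m * N" "j < N" by auto
    then show "(E * D) $$ (i, j) = ?R $$ (i, j)"
      using E_mult[of D N i j] block_index_less by (simp add: D_def)
  qed (auto simp: E_def D_def)
  have Z: "max_block_mat N m Z \<in> carrier_mat (m * N) (m * N)"
    and CDE: "C \<in> carrier_mat N (m * N)" "D \<in> carrier_mat N N" "E * D \<in> carrier_mat (m * N) N"
    by (simp_all add: mult_carrier_mat[of _ _ N])
  have "U * four_block_mat (max_block_mat N m Z) (0\<^sub>m (m * N) N) C D =
      four_block_mat (max_block_mat N m Z + E * C) (E * D) C D"
    unfolding U_def
    by (subst mult_four_block_mat[where ?nr1.0 = "m * N" and ?n1.0 = "m * N" and ?n2.0 = N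
        and ?nr2.0 = N and ?nc1.0 = "m * N" and ?nc2.0 = N])
       (simp_all add: left_mult_one_mat[OF Z] left_mult_zero_mat[OF Z] left_mult_one_mat[OF CDE(1)]
         left_mult_one_mat[OF CDE(2)] left_add_zero_mat[OF CDE(1)] left_add_zero_mat[OF CDE(2)]
         left_add_zero_mat[OF CDE(3)])
  also have "\<dots> = max_block_mat N (Suc m) Y"
    unfolding EC ED by (intro eq_matI) (auto simp: max_block_mat_def C_def D_def div_last
        max_absorb1 max_absorb2 block_index_less less_imp_le not_less)
  finally have "det (max_block_mat N (Suc m) Y) =
      det (U * four_block_mat (max_block_mat N m Z) (0\<^sub>m (m * N) N) C D)" by simp
  also have "\<dots> = det U * det (four_block_mat (max_block_mat N m Z) (0\<^sub>m (m * N) N) C D)"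
    by (rule det_mult[of _ "m * N + N"]) (auto simp: U_def)
  also have "det U = 1"
  proof -
    have U: "U \<in> carrier_mat (m * N + N) (m * N + N)" by (auto simp: U_def)
    have "upper_triangular U" by (auto simp: U_def upper_triangular_def E_def)
    moreover have "diag_mat U = replicate (m * N + N) 1"
      by (rule nth_equalityI) (auto simp: diag_mat_def U_def)
    ultimately show ?thesis using det_upper_triangular[OF _ U] by simp
  qed
  also have "det (four_block_mat (max_block_mat N m Z) (0\<^sub>m (m * N) N) C D) =
      det (max_block_mat N m Z) * det D"
    by (rule det_four_block_mat_upper_right_zero_comm_ring) auto
  also have "det (max_block_mat N m Z) =
      (\<Prod>k<m. det (mat N N (\<lambda>(a, b). Z k a b - Z (Suc k) a b)))"
    by (rule Suc.IH) (simp add: Z_def)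
  \<comment> \<open>The boundary hypothesis now reads \<open>Y (Suc m) = 0\<close> on the relevant
    indices, which gives the last factor the same shape as the others.\<close>
  also have "D = mat N N (\<lambda>(a, b). Y m a b - Y (Suc m) a b)"
    using Suc.prems by (intro eq_matI) (auto simp: D_def)
  finally show ?case by (simp add: Z_def)
qed

section \<open>Permutations of rows and columns, and their signs\<close>

text \<open>The sign of \<open>p\<close> enters once for the rows and once, via transposition, for
  the columns; its square is 1.\<close>

lemma det_permute_rows_cols:
  fixes A :: "'a :: comm_ring_1 mat"
  assumes A: "A \<in> carrier_mat n n" and p: "p permutes {0..<n}"
  shows "det (mat n n (\<lambda>(i, j). A $$ (p i, p j))) = det A"
proof -
  define R where "R = mat n n (\<lambda>(i, j). A\<^sup>T $$ (p i, j))"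
  have pn: "p i < n" if "i < n" for i using permutes_in_image[OF p, of i] that by auto
  have "mat n n (\<lambda>(i, j). A $$ (p i, p j)) = mat n n (\<lambda>(i, j). R\<^sup>T $$ (p i, j))"
    using A pn by (intro eq_matI) (auto simp: R_def)
  also have "det \<dots> = signof p * det (R\<^sup>T)"
    by (rule det_permute_rows[OF _ p]) (simp add: R_def)
  also have "det (R\<^sup>T) = det R" by (rule det_transpose[of _ n]) (simp add: R_def)
  also have "det R = signof p * det (A\<^sup>T)"
    unfolding R_def by (rule det_permute_rows[OF _ p]) (use A in simp)
  also have "det (A\<^sup>T) = det A" by (rule det_transpose[OF A])
  also have "signof p * (signof p * det A) = det A"
    by (simp add: sign_def)
  finally show ?thesis .
qed

definition rev_range :: "nat \<Rightarrow> nat \<Rightarrow> nat \<Rightarrow> nat" where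
  "rev_range a m i = (if a \<le> i \<and> i < a + m then 2 * a + m - 1 - i else i)"

text \<open>The reversal is an involution and hence its own inverse.\<close>

lemma rev_range_permutes:
  assumes "a + m \<le> n"
  shows "rev_range a m permutes {0..<n}"
proof (rule bij_imp_permutes)
  show "bij_betw (rev_range a m) {0..<n} {0..<n}"
    by (rule bij_betw_byWitness[where f' = "rev_range a m"])
       (use assms in \<open>auto simp: rev_range_def\<close>)
qed (use assms in \<open>auto simp: rev_range_def\<close>)

text \<open>Reversing \<open>m + 2\<close> points swaps the two end points and reverses the inner
  \<open>m\<close>, so each step of two contributes one factor -1.\<close>

lemma sign_rev_range: "sign (rev_range a m) = (-1) ^ (m div 2)"
proof (induction m arbitrary: a rule: induct_nat_012)
  case 0
  have "rev_range a 0 = id" by (auto simp: rev_range_def)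
  then show ?case by simp
next
  case 1
  have "rev_range a (Suc 0) = id" by (rule ext) (auto simp: rev_range_def)
  then show ?case by simp
next
  case (ge2 m)
  have "rev_range a (Suc (Suc m)) = transpose a (a + m + 1) \<circ> rev_range (a + 1) m"
    by (rule ext) (auto simp: rev_range_def transpose_def)
  moreover have "permutation (rev_range (a + 1) m)"
    using rev_range_permutes[of "a + 1" m "a + 1 + m"] by (auto simp: permutation_permutes)
  moreover have "permutation (transpose a (a + m + 1))" by (rule permutation_swap_id)
  ultimately have "sign (rev_range a (Suc (Suc m))) =
      sign (transpose a (a + m + 1)) * sign (rev_range (a + 1) m)"
    by (simp only: sign_compose)
  then show ?case
    by (simp add: sign_swap_id ge2)
qed

text \<open>Blocks are counted from 0, so an odd \<open>k\<close> stands for the even block row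
  \<open>k + 1\<close>, which consists of \<open>D_mat\<close> blocks.\<close>

primrec rev_odd_blocks :: "nat \<Rightarrow> nat \<Rightarrow> nat \<Rightarrow> nat" where
  "rev_odd_blocks m 0 = id"
| "rev_odd_blocks m (Suc k) = (if odd k then rev_range (k * m) m \<circ> rev_odd_blocks m k
     else rev_odd_blocks m k)"

lemma rev_odd_blocks_permutes: "rev_odd_blocks m k permutes {0..<k * m}"
proof (induction k)
  case (Suc k)
  then have "rev_odd_blocks m k permutes {0..<Suc k * m}"
    by (rule permutes_subset) auto
  then show ?case by (auto intro!: permutes_compose rev_range_permutes)
qed (simp add: id_def)

text \<open>There are \<open>k div 2\<close> odd numbers below \<open>k\<close>, each giving one
  reversal of \<open>m\<close> points.\<close>

lemma sign_rev_odd_blocks: "sign (rev_odd_blocks m k) = (-1) ^ ((k div 2) * (m div 2))"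
proof (induction k)
  case (Suc k)
  have "permutation (rev_odd_blocks m k)" "permutation (rev_range (k * m) m)"
    using rev_odd_blocks_permutes[of m k] rev_range_permutes[of "k * m" m "k * m + m"]
    by (auto simp: permutation_permutes)
  then show ?case using Suc
    by (auto simp: sign_compose sign_rev_range power_add elim!: oddE evenE)
qed simp

text \<open>The reversed ranges are disjoint, so at most one reversal moves a given index.\<close>

lemma rev_odd_blocks_apply:
  assumes "p < m"
  shows "rev_odd_blocks m k (r * m + p) =
    r * m + (if odd r \<and> r < k then m - 1 - p else p)"
proof (induction k)
  case (Suc k)
  have *: "rev_range (k * m) m (r * m + q) = r * m + (if r = k then m - 1 - q else q)"
    if "q < m" for q
  proof (cases r k rule: linorder_cases)
    case less
    then have "Suc r * m \<le> k * m" by (intro mult_le_mono1) auto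
    with less that show ?thesis by (auto simp: rev_range_def)
  next
    case greater
    then have "Suc k * m \<le> r * m" by (intro mult_le_mono1) auto
    with greater that show ?thesis by (auto simp: rev_range_def)
  qed (use that in \<open>auto simp: rev_range_def\<close>)
  from assms have "m - 1 - p < m" by auto
  with assms Suc show ?case by (auto simp: * less_Suc_eq)
qed simp

text \<open>This shuffle sends the position of \<open>(r, p)\<close> in \<open>N\<close> blocks of
  size \<open>m\<close> to that of \<open>(p, r)\<close> in \<open>m\<close> blocks of size
  \<open>N\<close>.\<close>

definition block_transpose :: "nat \<Rightarrow> nat \<Rightarrow> nat \<Rightarrow> nat" where
  "block_transpose N m i = (if i < N * m then (i mod m) * N + i div m else i)"

lemma block_index_bound:
  fixes p r :: nat
  assumes "p < m" "r < N"
  shows "p * N + r < m * N"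
proof -
  have "p * N + r < Suc p * N" using assms by simp
  also have "\<dots> \<le> m * N" using assms by (intro mult_le_mono1) auto
  finally show ?thesis .
qed

text \<open>The inverse is \<open>block_transpose m N\<close>, with the roles of the two sizes
  exchanged.\<close>

lemma block_transpose_permutes: "block_transpose N m permutes {0..<N * m}"
proof (rule bij_imp_permutes)
  have aux: "block_transpose N m i < N * m \<and> block_transpose m N (block_transpose N m i) = i"
    if "i < N * m" for N m i
  proof -
    have "i mod m < m" using that by (cases "m = 0") auto
    moreover have "i div m < N" using that by (simp add: less_mult_imp_div_less)
    ultimately have "(i mod m) * N + i div m < m * N" "i div m < N"
      by (auto intro: block_index_bound)
    then show ?thesis using that
      by (auto simp: block_transpose_def mult.commute)
  qed
  show "bij_betw (block_transpose N m) {0..<N * m} {0..<N * m}"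
    by (rule bij_betw_byWitness[where f' = "block_transpose m N"])
       (use aux[of _ N m] aux[of _ m N] in \<open>auto simp: mult.commute\<close>)
qed (auto simp: block_transpose_def)

section \<open>The determinant of \<open>F_mat\<close>\<close>

theorem theorem3p3:
  fixes N m :: nat and x :: "nat \<Rightarrow> nat \<Rightarrow> nat \<Rightarrow> 'a :: comm_ring_1"
  assumes "N \<ge> 2" and "m \<ge> 1"
    and "\<And>r s. 1 \<le> r \<Longrightarrow> r \<le> N \<Longrightarrow> 1 \<le> s \<Longrightarrow> s \<le> N \<Longrightarrow> x r s (m + 1) = 0"
  shows "det (F_mat N m x) =
    (if even N \<and> even m then (-1) ^ (N * m div 4) * (\<Prod>i = 1..m. det (X_mat N x i))
     else if even N \<and> odd m then (-1) ^ (N * (m - 1) div 4) * (\<Prod>i = 1..m. det (X_mat N x i))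
     else if odd N \<and> even m then (-1) ^ ((N - 1) * m div 4) * (\<Prod>i = 1..m. det (X_mat N x i))
     else (-1) ^ ((N - 1) * (m - 1) div 4) * (\<Prod>i = 1..m. det (X_mat N x i)))"
proof -
  \<comment> \<open>After the shift to indices from 0, the assumption on
    \<open>x r s (m + 1)\<close> becomes the vanishing of \<open>Y m\<close>.\<close>
  define Y where "Y k a b = x (a + 1) (b + 1) (k + 1)" for k a b
  \<comment> \<open>\<open>G\<close> is \<open>F_mat\<close> with every block of type
    \<open>B_mat\<close>, written as a reindexing of \<open>max_block_mat\<close>.\<close>
  define G where "G = mat (N * m) (N * m)
    (\<lambda>(i, j). max_block_mat N m Y $$ (block_transpose N m i, block_transpose N m j))"
  have G: "G $$ (r * m + p, s * m + q) = x (r + 1) (s + 1) (max p q + 1)"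
    if "r < N" "s < N" "p < m" "q < m" for r s p q
    using that block_index_bound[of r N p m] block_index_bound[of s N q m]
      block_index_bound[of p m r N] block_index_bound[of q m s N]
    by (simp add: G_def block_transpose_def max_block_mat_def Y_def)
  have "F_mat N m x = mat (N * m) (N * m) (\<lambda>(i, j). G $$ (rev_odd_blocks m N i, j))"
    (is "_ = ?R")
  proof (rule eq_matI)
    fix i j
    assume "i < dim_row ?R" "j < dim_col ?R"
    then have ij: "i < N * m" "j < N * m" by auto
    define r p s q where "r = i div m" and "p = i mod m" and "s = j div m" and "q = j mod m"
    have bounds: "r < N" "p < m" "s < N" "q < m"
      using ij assms(2) by (auto simp: r_def p_def s_def q_def less_mult_imp_div_less)
    have i: "i = r * m + p" and j: "j = s * m + q"
      by (auto simp: r_def p_def s_def q_def)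
    \<comment> \<open>Row \<open>p\<close> counted from 0 is reversed to \<open>m - 1 - p\<close>;
      counted from 1 this is \<open>m - p\<close>, the row index \<open>m + 1 - (p + 1)\<close> in
      \<open>D_mat\<close>.\<close>
    have [simp]: "m - Suc p < m" "Suc (m - Suc p) = m - p" using bounds by auto
    have "F_mat N m x $$ (i, j) = F_block m x (r + 1) (s + 1) $$ (p, q)"
      using ij by (simp add: F_mat_def r_def p_def s_def q_def)
    also have "\<dots> = G $$ (rev_odd_blocks m N i, j)"
      using bounds unfolding i j
      by (simp add: rev_odd_blocks_apply G F_block_def B_mat_def D_mat_def flip: max_Suc_Suc)
    finally show "F_mat N m x $$ (i, j) = ?R $$ (i, j)"
      using ij by simp
  qed (auto simp: F_mat_def)
  also have "det \<dots> = signof (rev_odd_blocks m N) * det G"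
    by (rule det_permute_rows[OF _ rev_odd_blocks_permutes]) (simp add: G_def)
  also have "det G = det (max_block_mat N m Y)"
    unfolding G_def
    by (rule det_permute_rows_cols[OF _ block_transpose_permutes])
       (metis max_block_mat_carrier mult.commute)
  also have "\<dots> = (\<Prod>k<m. det (X_mat N x (Suc k)))"
    using assms(3) by (subst det_max_block_mat) (auto simp: Y_def X_mat_def)
  also have "\<dots> = (\<Prod>i = 1..m. det (X_mat N x i))"
    by (simp add: prod.atLeast1_atMost_eq)
  \<comment> \<open>In all four parity cases the division by 4 is exact and the exponent equals
    \<open>(N div 2) * (m div 2)\<close>.\<close>
  finally show ?thesis
    by (auto simp: sign_rev_odd_blocks elim!: evenE oddE)
qed

end
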